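(* Let $K$ be a field of characteristic $0$, $n\ge1$, let $(U,\cdot,\omega)$ be a strong $n$-Lie-Poisson algebra over $K$, and let $D\in\mathrm{Der}(U,\cdot,\omega)$. Construct on $U$ a new skew-symmetric $(n+1)$-multiplication $\bar\omega=D\wedge\omega$, i.e. $$\bar\omega(u_0,u_1,\ldots,u_n)=\sum_{i=0}^n(-1)^iD(u_i)\cdot\omega(u_0,\ldots,\widehat{u_i},\ldots,u_n).$$ Then $(U,\cdot,\bar\omega)$ is a strong $(n+1)$-Lie-Poisson algebra.
   Context: For $m\ge1$, an $m$-Lie algebra $(U,\omega)$ is a vector space with a skew-symmetric $m$-linear map $\omega$ satisfying $$\omega(u_1,\ldots,u_{m-1},\omega(v_1,\ldots,v_m))=\sum_{i=1}^m\omega(v_1,\ldots,v_{i-1},\omega(u_1,\ldots,u_{m-1},v_i),v_{i+1},\ldots,v_m)$$ (for $m=1$ any linear map $\omega:U\to U$ is allowed). An $m$-Lie-Poisson algebra $(U,\cdot,\omega)$ consists of an associative commutative algebra $(U,\cdot)$ and an $m$-Lie algebra $(U,\omega)$ such that $\omega(u\cdot u',u_2,\ldots,u_m)=u\cdot\omega(u',u_2,\ldots,u_m)+u'\cdot\omega(u,u_2,\ldots,u_m)$. It is strong if for all $u_i,v_j\in U$ $$f^\omega(u_1,\ldots,u_{m-1},v_1,\ldots,v_{m+1}):=\sum_{i=1}^{m+1}(-1)^i\omega(u_1,\ldots,u_{m-1},v_i)\cdot\omega(v_1,\ldots,\widehat{v_i},\ldots,v_{m+1})=0 .$$ $\mathrm{Der}(U,\cdot,\omega)$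 is the set of linear maps $D:U\to U$ with $D(u\cdot v)=D(u)\cdot v+u\cdot D(v)$ and $D(\omega(u_1,\ldots,u_m))=\sum_i\omega(u_1,\ldots,D(u_i),\ldots,u_m)$. A hat means omission. *)

theory Defs
  imports Complex_Main
begin

text \<open>
  An m-ary operation on a type \<open>'u\<close> is a function \<open>'u list \<Rightarrow> 'u\<close> that is only ever
  applied to, and only constrained on, lists of length m; its values elsewhere are junk.
  List positions count from 0.
\<close>

definition omit :: "nat \<Rightarrow> 'u list \<Rightarrow> 'u list" where
  "omit i us = take i us @ drop (Suc i) us"

locale m_lie_algebra = vector_space scale
  for scale :: "'k::field \<Rightarrow> 'u::ab_group_add \<Rightarrow> 'u" +
  fixes m :: nat and \<omega> :: "'u list \<Rightarrow> 'u"
  assumes arity_pos: "1 \<le> m"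
    and multilinear: "\<And>us i. length us = m \<Longrightarrow> i < m \<Longrightarrow>
      Vector_Spaces.linear scale scale (\<lambda>x. \<omega> (us[i := x]))"
    and skew_symmetric: "\<And>us i j. length us = m \<Longrightarrow> i < m \<Longrightarrow> j < m \<Longrightarrow> i \<noteq> j \<Longrightarrow>
      \<omega> (us[i := us ! j, j := us ! i]) = - \<omega> us"
    and lie_identity: "\<And>us vs. length us = m - 1 \<Longrightarrow> length vs = m \<Longrightarrow>
      \<omega> (us @ [\<omega> vs]) = (\<Sum>i<m. \<omega> (vs[i := \<omega> (us @ [vs ! i])]))"

text \<open>
  The class \<open>comm_ring\<close> does not require a unit, and neither does the notion of an
  associative commutative algebra used here.
\<close>

locale comm_assoc_algebra = vector_space scale
  for scale :: "'k::field \<Rightarrow> 'u::comm_ring \<Rightarrow> 'u" +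
  assumes scale_mult_left: "\<And>c x y. scale c (x * y) = scale c x * y"

locale m_lie_poisson_algebra = comm_assoc_algebra scale + m_lie_algebra scale m \<omega>
  for scale :: "'k::field \<Rightarrow> 'u::comm_ring \<Rightarrow> 'u" and m :: nat and \<omega> :: "'u list \<Rightarrow> 'u" +
  assumes leibniz: "\<And>x y us. length us = m - 1 \<Longrightarrow>
      \<omega> ((x * y) # us) = x * \<omega> (y # us) + y * \<omega> (x # us)"

text \<open>
  The expression \<open>f\<^sup>\<omega>(u\<^sub>1,\<dots>,u\<^sub>m\<^sub>-\<^sub>1,v\<^sub>1,\<dots>,v\<^sub>m\<^sub>+\<^sub>1)\<close>; the exponent \<open>Suc i\<close> accounts for the shift
  to positions counted from 0. Signs are scalars, as \<open>'u\<close> need not have a unit.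
\<close>

definition strong_form ::
  "('k::field \<Rightarrow> 'u::comm_ring \<Rightarrow> 'u) \<Rightarrow> nat \<Rightarrow> ('u list \<Rightarrow> 'u) \<Rightarrow> 'u list \<Rightarrow> 'u list \<Rightarrow> 'u" where
  "strong_form scale m \<omega> us vs =
     (\<Sum>i<m + 1. scale ((-1) ^ Suc i) (\<omega> (us @ [vs ! i]) * \<omega> (omit i vs)))"

locale strong_m_lie_poisson_algebra = m_lie_poisson_algebra scale m \<omega>
  for scale :: "'k::field \<Rightarrow> 'u::comm_ring \<Rightarrow> 'u" and m :: nat and \<omega> :: "'u list \<Rightarrow> 'u" +
  assumes strong: "\<And>us vs. length us = m - 1 \<Longrightarrow> length vs = m + 1 \<Longrightarrow>
      strong_form scale m \<omega> us vs = 0"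

definition Der ::
  "('k::field \<Rightarrow> 'u::comm_ring \<Rightarrow> 'u) \<Rightarrow> nat \<Rightarrow> ('u list \<Rightarrow> 'u) \<Rightarrow> ('u \<Rightarrow> 'u) set" where
  "Der scale m \<omega> = {D. Vector_Spaces.linear scale scale D \<and>
     (\<forall>x y. D (x * y) = D x * y + x * D y) \<and>
     (\<forall>us. length us = m \<longrightarrow> D (\<omega> us) = (\<Sum>i<m. \<omega> (us[i := D (us ! i)])))}"

definition wedge ::
  "('k::field \<Rightarrow> 'u::comm_ring \<Rightarrow> 'u) \<Rightarrow> ('u \<Rightarrow> 'u) \<Rightarrow> ('u list \<Rightarrow> 'u) \<Rightarrow> 'u list \<Rightarrow> 'u" where
  "wedge scale D \<omega> us =
     (\<Sum>i<length us. scale ((-1) ^ i) (D (us ! i) * \<omega> (omit i us)))"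

end

theory Submission
  imports Defs
begin

text \<open>
  Expanding a list at its head turns the wedge product into
  \<open>(A \<and> F)(x, w) = A x \<cdot> F w - (A \<and> F(x, \<cdot>))(w)\<close>, and by induction on lists
  \<open>A \<and> (B \<and> F) = - B \<and> (A \<and> F)\<close> and \<open>A \<and> (A \<and> F) = 0\<close> for arbitrary
  functions. Strongness of \<open>\<omega>\<close> says \<open>Y \<and> \<omega> = 0\<close> for every \<open>Y = \<omega>(\<cdot>, u)\<close>; as
  \<open>\<omega>'(\<cdot>, u)\<close>, where \<open>\<omega>' = D \<and> \<omega>\<close>, is a combination of \<open>D\<close> and such \<open>Y\<close>, strongness of
  \<open>\<omega>'\<close> is anticommutativity. For the Lie identity let
  \<open>(X.F)(v) = X(F v) - \<Sum>\<^sub>i F(v\<^sub>1,\<dots>,X v\<^sub>i,\<dots>)\<close>. A derivation \<open>X\<close> of the product satisfies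
  \<open>X.(D \<and> \<omega>) = [X, D] \<and> \<omega> + D \<and> (X.\<omega>)\<close>, and \<open>(aY).\<omega> = - Y \<and> \<omega>(a, \<cdot>)\<close> when \<open>Y\<close> is a
  derivation of both operations. With \<open>Y \<and> \<omega> = 0\<close> this gives
  \<open>(aY).\<omega>' = - Y(a) \<omega>'\<close> for \<open>Y = \<omega>(\<cdot>, u)\<close>, and \<open>(bD).\<omega>' = - D(b) \<omega>'\<close>. For
  \<open>X = \<omega>'(\<cdot>, u)\<close> these multiples of \<open>\<omega>'\<close> cancel because \<open>D\<close> is a derivation of \<open>\<omega>\<close>.
\<close>

section \<open>The wedge product on lists\<close>

lemma omit_0 [simp]: "omit 0 (x # w) = w"
  and omit_Suc [simp]: "omit (Suc i) (x # w) = x # omit i w"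
  by (simp_all add: omit_def)

lemma length_omit: "i < length w \<Longrightarrow> Suc (length (omit i w)) = length w"
  by (simp add: omit_def)

text \<open>Only lists one shorter than \<open>v\<close> reach \<open>F\<close>, so laws that hold
  at one fixed arity can be rewritten under the wedge.\<close>

lemma wedge_cong:
  assumes "\<And>x. x \<in> set v \<Longrightarrow> A x = B x"
    and "\<And>w. Suc (length w) = length v \<Longrightarrow> F w = G w"
  shows "wedge scale A F v = wedge scale B G v"
  unfolding wedge_def by (intro sum.cong refl) (simp add: assms length_omit)

text \<open>The sum from \<open>Der\<close>, with the arity read off the list so that induction can
  pass to \<open>\<lambda>z. F (x # z)\<close>.\<close>

definition leibniz_sum :: "('u::comm_monoid_add \<Rightarrow> 'u) \<Rightarrow> ('u list \<Rightarrow> 'u) \<Rightarrow> 'u list \<Rightarrow> 'u" where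
  "leibniz_sum X F w = (\<Sum>i<length w. F (w[i := X (w ! i)]))"

lemma leibniz_sum_Nil [simp]: "leibniz_sum X F [] = 0"
  by (simp add: leibniz_sum_def)

lemma leibniz_sum_Cons [simp]:
  "leibniz_sum X F (x # w) = F (X x # w) + leibniz_sum X (\<lambda>z. F (x # z)) w"
  by (simp add: leibniz_sum_def sum.lessThan_Suc_shift del: sum.lessThan_Suc)

lemma leibniz_sum_diff:
  fixes F G :: "'u::ab_group_add list \<Rightarrow> 'u"
  shows "leibniz_sum X (\<lambda>w. F w - G w) v = leibniz_sum X F v - leibniz_sum X G v"
  by (simp add: leibniz_sum_def sum_subtractf)

lemma leibniz_sum_mult_left:
  fixes F :: "'u::comm_ring list \<Rightarrow> 'u"
  shows "leibniz_sum X (\<lambda>w. c * F w) v = c * leibniz_sum X F v"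
  by (simp add: leibniz_sum_def sum_distrib_left)

section \<open>Skew-symmetry and multilinearity in terms of list splittings\<close>

text \<open>Adjacent swaps generate all transpositions, and the form with prefix and suffix passes
  to \<open>F\<close> with its first entry frozen.\<close>

definition adj_skew :: "nat \<Rightarrow> ('u::ab_group_add list \<Rightarrow> 'u) \<Rightarrow> bool" where
  "adj_skew m F \<longleftrightarrow>
     (\<forall>p a b r. length p + length r + 2 = m \<longrightarrow> F (p @ a # b # r) = - F (p @ b # a # r))"

lemma adj_skewD:
  "adj_skew m F \<Longrightarrow> length p + length r + 2 = m \<Longrightarrow> F (p @ a # b # r) = - F (p @ b # a # r)"
  unfolding adj_skew_def by blast

lemma adj_skew_Cons: "adj_skew (Suc m) F \<Longrightarrow> adj_skew m (\<lambda>z. F (x # z))"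
  unfolding adj_skew_def by (metis add_Suc append_Cons length_Cons)

definition multilinear_on ::
  "('k::field \<Rightarrow> 'u::ab_group_add \<Rightarrow> 'u) \<Rightarrow> nat \<Rightarrow> ('u list \<Rightarrow> 'u) \<Rightarrow> bool" where
  "multilinear_on scale m F \<longleftrightarrow>
     (\<forall>p r. Suc (length p + length r) = m \<longrightarrow>
        Vector_Spaces.linear scale scale (\<lambda>x. F (p @ x # r)))"

lemma multilinear_onD:
  "multilinear_on scale m F \<Longrightarrow> Suc (length p + length r) = m \<Longrightarrow>
    Vector_Spaces.linear scale scale (\<lambda>x. F (p @ x # r))"
  by (simp add: multilinear_on_def)

lemma multilinear_on_Cons:
  "multilinear_on scale (Suc m) F \<Longrightarrow> multilinear_on scale m (\<lambda>z. F (x # z))"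
  using multilinear_onD [of scale "Suc m" F "x # p" for p] by (simp add: multilinear_on_def)

context vector_space
begin

lemma linear_iff_add_scale:
  "Vector_Spaces.linear scale scale f \<longleftrightarrow>
    (\<forall>x y. f (x + y) = f x + f y) \<and> (\<forall>c x. f (scale c x) = scale c (f x))"
  by (auto simp: Vector_Spaces.linear_iff intro: vector_space_axioms)

lemma scale_neg_one_power_cancel [simp]: "scale ((-1) ^ k) (scale ((-1) ^ k) x) = x"
  by (simp add: power_mult_distrib [symmetric])

lemma adj_skew_move:
  assumes "adj_skew m F" and "Suc (length p + length q + length r) = m"
  shows "F (p @ a # q @ r) = scale ((-1) ^ length q) (F (p @ q @ a # r))"
  using assms(2)
proof (induction q arbitrary: p)
  case (Cons b q)
  have "F (p @ a # b # q @ r) = - F (p @ b # a # q @ r)"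
    using adj_skewD [OF assms(1), of p "q @ r" a b] Cons.prems by simp
  moreover have "F ((p @ [b]) @ a # q @ r) = scale ((-1) ^ length q) (F ((p @ [b]) @ q @ a # r))"
    using Cons.prems by (intro Cons.IH) simp
  ultimately show ?case by simp
qed simp

text \<open>The entry \<open>b\<close> moves right past \<open>q\<close>, is swapped with
  \<open>a\<close>, and \<open>a\<close> moves left past \<open>q\<close>. The two moves carry equal
  signs, so only the sign of the adjacent swap remains.\<close>

lemma adj_skew_swap:
  fixes F :: "'b list \<Rightarrow> 'b"
  assumes F: "adj_skew m F" and "length us = m" "i < m" "j < m" "i \<noteq> j"
  shows "F (us[i := us ! j, j := us ! i]) = - F us"
proof -
  have *: "F (us[i := us ! j, j := us ! i]) = - F us"
    if "length us = m" "i < j" "j < m" for us i j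
  proof -
    define p q r where "p = take i us" and "q = drop (Suc i) (take j us)" and "r = drop (Suc j) us"
    define a b where "a = us ! i" and "b = us ! j"
    have "take j us = p @ a # q"
      using that id_take_nth_drop [of i "take j us"] by (simp add: p_def q_def a_def min_def)
    then have us: "us = p @ a # q @ b # r"
      using that id_take_nth_drop [of j us] by (simp add: b_def r_def)
    have i: "i = length p" and j: "j = Suc (length p + length q)"
      using that by (simp_all add: p_def q_def)
    have swapped: "us[i := us ! j, j := us ! i] = p @ b # q @ a # r"
      unfolding us i j by (simp add: nth_append list_update_append)
    have len: "Suc (Suc (length p + length q + length r)) = m"
      using us that(1) by simp
    have "F (p @ b # q @ a # r) = scale ((-1) ^ length q) (F ((p @ q) @ b # a # r))"
      using adj_skew_move [OF F, of p q "a # r" b] len by simp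
    also have "\<dots> = - scale ((-1) ^ length q) (F ((p @ q) @ a # b # r))"
      using adj_skewD [OF F, of "p @ q" r b a] len by simp
    also have "\<dots> = - F (p @ a # q @ b # r)"
      using adj_skew_move [OF F, of p q "b # r" a] len by simp
    finally show ?thesis by (simp only: swapped us [symmetric])
  qed
  show ?thesis
  proof (cases "i < j")
    case False
    then have "us[i := us ! j, j := us ! i] = us[j := us ! i, i := us ! j]"
      using assms(5) by (simp add: list_update_swap)
    with * [of us j i] False assms show ?thesis by simp
  qed (use * assms in simp)
qed

text \<open>Turns a term of a Leibniz sum into a term of a wedge product: the new entry is pulled to
  the head past \<open>j\<close> others.\<close>

lemma adj_skew_update:
  assumes "adj_skew (length w) F" and "j < length w"
  shows "F (w[j := b]) = scale ((-1) ^ j) (F (b # omit j w))"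
proof -
  have "F ([] @ b # take j w @ drop (Suc j) w)
      = scale ((-1) ^ length (take j w)) (F ([] @ take j w @ b # drop (Suc j) w))"
    using assms(2) by (intro adj_skew_move [OF assms(1)]) simp
  then show ?thesis
    using assms(2) by (simp add: omit_def upd_conv_take_nth_drop)
qed

text \<open>The Lie identity and strongness put the varying entry last, while list recursion needs
  it at the head.\<close>

lemma adj_skew_last:
  assumes "adj_skew (Suc (length us)) F"
  shows "F (us @ [y]) = scale ((-1) ^ length us) (F (y # us))"
  using adj_skew_move [OF assms, of "[]" us "[]" y] by simp

end

section \<open>Algebraic rules for the wedge product\<close>

context comm_assoc_algebra
begin

lemma scale_mult_right: "scale c (x * y) = x * scale c y"
  by (metis mult.commute scale_mult_left)

lemma wedge_Nil [simp]: "wedge scale A F [] = 0"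
  by (simp add: wedge_def)

lemma wedge_Cons [simp]:
  "wedge scale A F (x # w) = A x * F w - wedge scale A (\<lambda>z. F (x # z)) w"
  by (simp add: wedge_def sum.lessThan_Suc_shift sum_negf del: sum.lessThan_Suc)

lemma wedge_add: "wedge scale A (\<lambda>w. F w + G w) v = wedge scale A F v + wedge scale A G v"
  by (simp add: wedge_def sum.distrib distrib_left scale_right_distrib)

lemma wedge_diff: "wedge scale A (\<lambda>w. F w - G w) v = wedge scale A F v - wedge scale A G v"
  by (simp add: wedge_def sum_subtractf right_diff_distrib scale_right_diff_distrib)

lemma wedge_minus: "wedge scale A (\<lambda>w. - F w) v = - wedge scale A F v"
  by (simp add: wedge_def sum_negf)

lemma wedge_mult_left: "wedge scale A (\<lambda>w. c * F w) v = c * wedge scale A F v"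
  by (simp add: wedge_def sum_distrib_left scale_mult_right [symmetric] mult.left_commute)

lemma wedge_scale: "wedge scale A (\<lambda>w. scale c (F w)) v = scale c (wedge scale A F v)"
  by (simp add: wedge_def scale_sum_right scale_mult_right [symmetric] mult.commute)

lemma wedge_scale_left: "wedge scale (\<lambda>y. scale c (A y)) F v = scale c (wedge scale A F v)"
  by (simp add: wedge_def scale_sum_right scale_mult_left [symmetric] mult.commute [of c])

lemma wedge_diff_left: "wedge scale (\<lambda>y. A y - B y) F v = wedge scale A F v - wedge scale B F v"
  by (simp add: wedge_def sum_subtractf left_diff_distrib scale_right_diff_distrib)

lemma wedge_mult_left_left: "wedge scale (\<lambda>y. c * A y) F v = c * wedge scale A F v"
  by (simp add: wedge_def sum_distrib_left scale_mult_right [symmetric] mult.assoc)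

lemma wedge_sum_left: "wedge scale (\<lambda>y. \<Sum>i\<in>I. A i y) F v = (\<Sum>i\<in>I. wedge scale (A i) F v)"
  unfolding wedge_def
  by (subst sum.swap) (simp add: sum_distrib_right scale_sum_right)

text \<open>Expanding at the head \<open>x\<close> leaves
  \<open>A x * wedge scale B F w - B x * wedge scale A F w\<close>, antisymmetric in
  \<open>A\<close> and \<open>B\<close>, plus the double wedge on \<open>w\<close> of
  \<open>F\<close> with \<open>x\<close> frozen, to which induction applies.\<close>

lemma wedge_anticommute:
  "wedge scale A (wedge scale B F) v = - wedge scale B (wedge scale A F) v"
  by (induction v arbitrary: F) (simp_all add: wedge_diff wedge_mult_left)

text \<open>Needs its own induction over a general field: anticommutativity only shows that twice
  the value is zero.\<close>

lemma wedge_self: "wedge scale A (wedge scale A F) v = 0"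
  by (induction v arbitrary: F) (simp_all add: wedge_diff wedge_mult_left)

lemma adj_skew_wedge:
  assumes "adj_skew m F"
  shows "adj_skew (Suc m) (wedge scale A F)"
proof -
  have "wedge scale A F (p @ a # b # r) = - wedge scale A F (p @ b # a # r)"
    if "adj_skew m F" "length p + length r + 2 = Suc m" for m F p a b r
    using that
  proof (induction p arbitrary: m F)
    case Nil
    \<comment> \<open>The remaining terms \<open>A a * F (b # r) - A b * F (a # r)\<close> are
      already antisymmetric in \<open>a\<close> and \<open>b\<close>.\<close>
    have "wedge scale A (\<lambda>z. F (a # b # z)) r = wedge scale A (\<lambda>z. - F (b # a # z)) r"
      using Nil(2) adj_skewD [OF Nil(1), of "[]" _ a b] by (intro wedge_cong) auto
    then show ?case by (simp add: wedge_minus)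
  next
    case (Cons y p)
    then obtain k where k: "m = Suc k" by (cases m) auto
    have "F (p @ a # b # r) = - F (p @ b # a # r)"
      using Cons.prems by (intro adj_skewD [of m]) auto
    moreover have "wedge scale A (\<lambda>z. F (y # z)) (p @ a # b # r)
        = - wedge scale A (\<lambda>z. F (y # z)) (p @ b # a # r)"
      using Cons.prems k by (intro Cons.IH [of k] adj_skew_Cons) auto
    ultimately show ?case by simp
  qed
  with assms show ?thesis by (subst adj_skew_def) blast
qed

lemma linear_wedge:
  assumes "\<And>z. Suc (length z) = length r \<Longrightarrow> Vector_Spaces.linear scale scale (\<lambda>x. F x z)"
  shows "Vector_Spaces.linear scale scale (\<lambda>x. wedge scale A (F x) r)"
proof -
  have "wedge scale A (F (x + y)) r = wedge scale A (\<lambda>z. F x z + F y z) r" for x y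
    using assms by (intro wedge_cong) (auto simp: linear_iff_add_scale)
  moreover have "wedge scale A (F (scale c x)) r = wedge scale A (\<lambda>z. scale c (F x z)) r" for c x
    using assms by (intro wedge_cong) (auto simp: linear_iff_add_scale)
  ultimately show ?thesis
    by (simp add: linear_iff_add_scale wedge_add wedge_scale)
qed

lemma multilinear_on_wedge:
  assumes A: "Vector_Spaces.linear scale scale A" and "multilinear_on scale m F"
  shows "multilinear_on scale (Suc m) (wedge scale A F)"
proof -
  have "Vector_Spaces.linear scale scale (\<lambda>x. wedge scale A F (p @ x # r))"
    if "multilinear_on scale m F" "Suc (length p + length r) = Suc m" for m F p r
    using that
  proof (induction p arbitrary: m F)
    case Nil
    have "Vector_Spaces.linear scale scale (\<lambda>x. wedge scale A (\<lambda>z. F (x # z)) r)"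
      using Nil multilinear_onD [OF Nil(1), of "[]"] by (intro linear_wedge) auto
    with A show ?case
      by (simp add: linear_iff_add_scale scale_mult_left scale_right_diff_distrib algebra_simps)
  next
    case (Cons y p)
    then obtain k where k: "m = Suc k" by (cases m) auto
    have "Vector_Spaces.linear scale scale (\<lambda>x. F (p @ x # r))"
      using Cons.prems by (intro multilinear_onD [of scale m]) auto
    moreover have "Vector_Spaces.linear scale scale (\<lambda>x. wedge scale A (\<lambda>z. F (y # z)) (p @ x # r))"
      using Cons.prems k by (intro Cons.IH [of k] multilinear_on_Cons) auto
    ultimately show ?case
      by (simp add: linear_iff_add_scale scale_mult_right scale_right_diff_distrib algebra_simps)
  qed
  with assms(2) show ?thesis by (simp add: multilinear_on_def)
qed

text \<open>At the head, \<open>X (D x * F w)\<close> gives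
  \<open>X (D x) * F w + D x * X (F w)\<close>, and the Leibniz sum removes
  \<open>D (X x) * F w\<close>, which leaves the commutator of \<open>X\<close> and
  \<open>D\<close>.\<close>

lemma derivation_wedge:
  assumes add: "\<And>x y. X (x + y) = X x + X y" and mult: "\<And>x y. X (x * y) = X x * y + x * X y"
  shows "X (wedge scale D F v) - leibniz_sum X (wedge scale D F) v =
    wedge scale (\<lambda>y. X (D y) - D (X y)) F v + wedge scale D (\<lambda>w. X (F w) - leibniz_sum X F w) v"
proof (induction v arbitrary: F)
  case Nil
  show ?case using add [of 0 0] by simp
next
  case (Cons x w)
  have diff: "X (a - b) = X a - X b" for a b
    using add [of "a - b" b] by simp
  show ?case
    using Cons.IH [of "\<lambda>z. F (x # z)"]
    by (simp add: diff mult wedge_diff wedge_add leibniz_sum_diff leibniz_sum_mult_left algebra_simps)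
qed

text \<open>The minus sign comes from the exponent \<open>Suc i\<close> in place of
  \<open>i\<close>.\<close>

lemma strong_form_eq_wedge:
  assumes "length vs = m + 1"
  shows "strong_form scale m F us vs = - wedge scale (\<lambda>y. F (us @ [y])) F vs"
  using assms by (simp add: strong_form_def wedge_def sum_negf del: sum.lessThan_Suc)

end

section \<open>Strong Lie-Poisson algebras\<close>

context m_lie_algebra
begin

lemma adj_skew_bracket: "adj_skew m \<omega>"
proof -
  have "\<omega> (p @ a # b # r) = - \<omega> (p @ b # a # r)" if "length p + length r + 2 = m" for p a b r
    using skew_symmetric [of "p @ b # a # r" "length p" "Suc (length p)"] that
    by (simp add: nth_append list_update_append)
  then show ?thesis unfolding adj_skew_def by blast
qed

lemma multilinear_on_bracket: "multilinear_on scale m \<omega>"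
proof -
  have "Vector_Spaces.linear scale scale (\<lambda>x. \<omega> (p @ x # r))"
    if "Suc (length p + length r) = m" for p r
    \<comment> \<open>The entry \<open>undefined\<close> is a placeholder that every update
      overwrites.\<close>
    using multilinear [of "p @ undefined # r" "length p"] that by simp
  then show ?thesis by (simp add: multilinear_on_def)
qed

lemma linear_bracket_head:
  "Suc (length us) = m \<Longrightarrow> Vector_Spaces.linear scale scale (\<lambda>y. \<omega> (y # us))"
  using multilinear_onD [OF multilinear_on_bracket, of "[]" us] by simp

lemma bracket_last: "Suc (length us) = m \<Longrightarrow> \<omega> (us @ [y]) = scale ((-1) ^ length us) (\<omega> (y # us))"
  using adj_skew_last adj_skew_bracket by simp

end

context m_lie_poisson_algebra
begin

text \<open>With \<open>a * Y (w ! i)\<close> pulled to the head, the Leibniz rule gives two terms: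
  one returns to position \<open>i\<close>, the other keeps \<open>a\<close> at the head with
  coefficient \<open>Y (w ! i)\<close>.\<close>

lemma leibniz_sum_mult_operator:
  assumes "length w = m"
  shows "leibniz_sum (\<lambda>y. a * Y y) \<omega> w = a * leibniz_sum Y \<omega> w + wedge scale Y (\<lambda>z. \<omega> (a # z)) w"
proof -
  have "\<omega> (w[i := a * Y (w ! i)])
      = a * \<omega> (w[i := Y (w ! i)]) + scale ((-1) ^ i) (Y (w ! i) * \<omega> (a # omit i w))"
    if "i < length w" for i
    using that length_omit [OF that] assms adj_skew_bracket
    by (simp add: adj_skew_update leibniz scale_right_distrib scale_mult_right)
  then show ?thesis
    by (simp add: leibniz_sum_def wedge_def sum.distrib sum_distrib_left)
qed

text \<open>Moving the varying entry of the Lie identity from last to first gives the same sign on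
  both sides, by linearity in each slot.\<close>

lemma bracket_head_in_Der:
  assumes len: "Suc (length us) = m"
  shows "(\<lambda>y. \<omega> (y # us)) \<in> Der scale m \<omega>"
proof -
  have "\<omega> (\<omega> vs # us) = (\<Sum>i<m. \<omega> (vs[i := \<omega> (vs ! i # us)]))" if "length vs = m" for vs
  proof -
    have lin: "\<omega> (vs[i := scale c x]) = scale c (\<omega> (vs[i := x]))" if "i < m" for i c x
      using multilinear [OF \<open>length vs = m\<close> that] by (simp add: linear_iff_add_scale)
    have "\<omega> (us @ [\<omega> vs]) = (\<Sum>i<m. \<omega> (vs[i := \<omega> (us @ [vs ! i])]))"
      using len that by (intro lie_identity) simp_all
    then have "scale ((-1) ^ length us) (\<omega> (\<omega> vs # us))
        = scale ((-1) ^ length us) (\<Sum>i<m. \<omega> (vs[i := \<omega> (vs ! i # us)]))"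
      by (simp add: bracket_last [OF len] lin scale_sum_right)
    then show ?thesis by simp
  qed
  then show ?thesis
    using linear_bracket_head [OF len] leibniz [of us] len
    by (auto simp: Der_def mult.commute add.commute)
qed

end

context strong_m_lie_poisson_algebra
begin

lemma wedge_bracket_eq_0:
  assumes "Suc (length us) = m" and "length vs = Suc m"
  shows "wedge scale (\<lambda>y. \<omega> (y # us)) \<omega> vs = 0"
proof -
  have "strong_form scale m \<omega> us vs = 0"
    using assms by (intro strong) auto
  then show ?thesis
    using assms by (simp add: strong_form_eq_wedge bracket_last wedge_scale_left)
qed

text \<open>Strongness on \<open>a # w\<close>, expanded at the head, evaluates the inner wedge at
  \<open>w\<close> as \<open>\<omega> (a # us) * \<omega> w\<close>.\<close>

lemma wedge_wedge_bracket_Cons: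
  assumes "Suc (length us) = m" and "length vs = Suc m"
  shows "wedge scale A (wedge scale (\<lambda>y. \<omega> (y # us)) (\<lambda>z. \<omega> (a # z))) vs
    = \<omega> (a # us) * wedge scale A \<omega> vs"
proof -
  have "wedge scale (\<lambda>y. \<omega> (y # us)) (\<lambda>z. \<omega> (a # z)) w = \<omega> (a # us) * \<omega> w"
    if "Suc (length w) = length vs" for w
    using wedge_bracket_eq_0 [of us "a # w"] that assms by simp
  then have "wedge scale A (wedge scale (\<lambda>y. \<omega> (y # us)) (\<lambda>z. \<omega> (a # z))) vs
      = wedge scale A (\<lambda>w. \<omega> (a # us) * \<omega> w) vs"
    by (intro wedge_cong) auto
  then show ?thesis by (simp add: wedge_mult_left)
qed

section \<open>The bracket \<open>wedge scale D \<omega>\<close> for a fixed derivation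
  \<open>D\<close>\<close>

context
  fixes D
  assumes D: "D \<in> Der scale m \<omega>"
begin

lemma D_mult: "D (x * y) = D x * y + x * D y"
  and D_bracket: "length us = m \<Longrightarrow> D (\<omega> us) = leibniz_sum D \<omega> us"
  using D by (auto simp: Der_def leibniz_sum_def)

text \<open>This is \<open>derivation_wedge\<close> for the derivation \<open>a * Y\<close>, whose
  commutator with \<open>D\<close> is \<open>a\<close> times that of \<open>Y\<close> minus
  \<open>D a * Y\<close>.\<close>

lemma derivation_multiple_wedge:
  assumes "length vs = Suc m" and Y: "Y \<in> Der scale m \<omega>"
  shows "a * Y (wedge scale D \<omega> vs) - leibniz_sum (\<lambda>y. a * Y y) (wedge scale D \<omega>) vs
    = a * wedge scale (\<lambda>y. Y (D y) - D (Y y)) \<omega> vs - D a * wedge scale Y \<omega> vs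
      - wedge scale D (wedge scale Y (\<lambda>z. \<omega> (a # z))) vs"
proof -
  have Y_add: "Y (x + y) = Y x + Y y"
    and Y_mult: "Y (x * y) = Y x * y + x * Y y"
    and Y_bracket: "length us = m \<Longrightarrow> Y (\<omega> us) = leibniz_sum Y \<omega> us" for x y us
    using Y by (auto simp: Der_def linear_iff_add_scale leibniz_sum_def)
  have "a * Y (wedge scale D \<omega> vs) - leibniz_sum (\<lambda>y. a * Y y) (wedge scale D \<omega>) vs
    = wedge scale (\<lambda>y. a * Y (D y) - D (a * Y y)) \<omega> vs
      + wedge scale D (\<lambda>w. a * Y (\<omega> w) - leibniz_sum (\<lambda>y. a * Y y) \<omega> w) vs"
    by (rule derivation_wedge) (simp_all add: Y_add Y_mult algebra_simps)
  also have "wedge scale (\<lambda>y. a * Y (D y) - D (a * Y y)) \<omega> vs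
    = wedge scale (\<lambda>y. a * (Y (D y) - D (Y y)) - D a * Y y) \<omega> vs"
    by (intro wedge_cong) (simp_all add: D_mult algebra_simps)
  also have "wedge scale D (\<lambda>w. a * Y (\<omega> w) - leibniz_sum (\<lambda>y. a * Y y) \<omega> w) vs
    = wedge scale D (\<lambda>w. - wedge scale Y (\<lambda>z. \<omega> (a # z)) w) vs"
    using assms(1) by (intro wedge_cong) (simp_all add: leibniz_sum_mult_operator Y_bracket)
  finally show ?thesis
    by (simp add: wedge_diff_left wedge_mult_left_left wedge_minus)
qed

text \<open>For \<open>Y = D\<close> the commutator is zero and the double wedge with
  \<open>D\<close> vanishes.\<close>

lemma D_multiple_wedge:
  assumes "length vs = Suc m"
  shows "a * D (wedge scale D \<omega> vs) - leibniz_sum (\<lambda>y. a * D y) (wedge scale D \<omega>) vs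
    = - (D a * wedge scale D \<omega> vs)"
proof -
  have "wedge scale (\<lambda>y. 0) \<omega> vs = 0"
    by (simp add: wedge_def)
  then show ?thesis
    using derivation_multiple_wedge [OF assms D, of a] by (simp add: wedge_self)
qed

lemma bracket_multiple_wedge:
  assumes vs: "length vs = Suc m" and us: "Suc (length us) = m"
  shows "a * \<omega> (wedge scale D \<omega> vs # us)
      - leibniz_sum (\<lambda>y. a * \<omega> (y # us)) (wedge scale D \<omega>) vs
    = - (\<omega> (a # us) * wedge scale D \<omega> vs)"
proof -
  \<comment> \<open>As \<open>D\<close> is a derivation of the bracket, the commutator is minus a
    sum of brackets with one entry of \<open>us\<close> replaced by its image under
    \<open>D\<close>; strongness kills the wedge of each with \<open>\<omega>\<close>.\<close>
  have "wedge scale (\<lambda>y. \<omega> (D y # us) - D (\<omega> (y # us))) \<omega> vs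
      = wedge scale (\<lambda>y. 0 - (\<Sum>i<length us. \<omega> (y # us[i := D (us ! i)]))) \<omega> vs"
    using us by (intro wedge_cong) (simp_all add: D_bracket, simp add: leibniz_sum_def)
  also have "\<dots> = wedge scale (\<lambda>y. 0) \<omega> vs
      - (\<Sum>i<length us. wedge scale (\<lambda>y. \<omega> (y # us[i := D (us ! i)])) \<omega> vs)"
    by (simp only: wedge_diff_left wedge_sum_left)
  also have "\<dots> = 0"
    using us vs by (simp add: wedge_bracket_eq_0) (simp add: wedge_def)
  finally show ?thesis
    using derivation_multiple_wedge [OF vs bracket_head_in_Der [OF us], of a] us vs
    by (simp add: wedge_bracket_eq_0 wedge_wedge_bracket_Cons)
qed

lemma multilinear_on_D_wedge: "multilinear_on scale (Suc m) (wedge scale D \<omega>)"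
  using D multilinear_on_bracket by (intro multilinear_on_wedge) (auto simp: Der_def)

lemma adj_skew_D_wedge: "adj_skew (Suc m) (wedge scale D \<omega>)"
  by (intro adj_skew_wedge adj_skew_bracket)

text \<open>Decomposes the operator in \<open>y\<close> into multiples of \<open>D\<close> and of
  brackets, the two cases treated above.\<close>

lemma wedge_head:
  "wedge scale D \<omega> (y # us) = \<omega> us * D y
    - (\<Sum>i<length us. scale ((-1) ^ i) (D (us ! i)) * \<omega> (y # omit i us))"
  by (simp add: wedge_def [of scale D "\<lambda>z. \<omega> (y # z)"] scale_mult_left mult.commute)

lemma D_bracket_head:
  assumes "length us = m"
  shows "D (\<omega> us) = (\<Sum>i<length us. \<omega> (scale ((-1) ^ i) (D (us ! i)) # omit i us))"
proof -
  have "\<omega> (us[i := D (us ! i)]) = \<omega> (scale ((-1) ^ i) (D (us ! i)) # omit i us)"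
    if "i < length us" for i
    using linear_bracket_head [of "omit i us"] length_omit [OF that] that assms adj_skew_bracket
    by (simp add: adj_skew_update linear_iff_add_scale)
  then show ?thesis
    using assms by (simp add: D_bracket leibniz_sum_def)
qed

lemma lie_identity_wedge_head:
  assumes us: "length us = m" and vs: "length vs = Suc m"
  shows "wedge scale D \<omega> (wedge scale D \<omega> vs # us)
    = leibniz_sum (\<lambda>y. wedge scale D \<omega> (y # us)) (wedge scale D \<omega>) vs"
proof -
  let ?W = "wedge scale D \<omega>"
  let ?a = "\<lambda>i. scale ((-1) ^ i) (D (us ! i))"
  have lin: "Vector_Spaces.linear scale scale (\<lambda>x. ?W (vs[j := x]))" if "j < length vs" for j
    using multilinear_onD [OF multilinear_on_D_wedge, of "take j vs" "drop (Suc j) vs"] that vs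
    by (simp add: upd_conv_take_nth_drop)
  have W_diff: "?W (vs[j := x - y]) = ?W (vs[j := x]) - ?W (vs[j := y])" if "j < length vs" for j x y
    using lin [OF that] by (rule module_hom.diff [OF Vector_Spaces.linear.axioms(3)])
  have W_sum: "?W (vs[j := \<Sum>i\<in>I. g i]) = (\<Sum>i\<in>I. ?W (vs[j := g i]))"
    if "j < length vs" for j and I :: "nat set" and g
    using lin [OF that] by (rule module_hom.sum [OF Vector_Spaces.linear.axioms(3)])
  \<comment> \<open>Linearity of \<open>?W\<close> in each slot makes the Leibniz sum linear in its
    operator, here split by \<open>wedge_head\<close>.\<close>
  have "leibniz_sum (\<lambda>y. ?W (y # us)) ?W vs
      = leibniz_sum (\<lambda>y. \<omega> us * D y) ?W vs
        - (\<Sum>i<m. leibniz_sum (\<lambda>y. ?a i * \<omega> (y # omit i us)) ?W vs)"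
    unfolding leibniz_sum_def
    by (simp add: wedge_head us W_diff W_sum sum_subtractf del: wedge_Cons) (rule sum.swap)
  then have "?W (?W vs # us) - leibniz_sum (\<lambda>y. ?W (y # us)) ?W vs
      = (\<omega> us * D (?W vs) - leibniz_sum (\<lambda>y. \<omega> us * D y) ?W vs)
        - (\<Sum>i<m. ?a i * \<omega> (?W vs # omit i us)
            - leibniz_sum (\<lambda>y. ?a i * \<omega> (y # omit i us)) ?W vs)"
    by (simp add: wedge_head us sum_subtractf del: wedge_Cons)
  also have "\<dots> = - (D (\<omega> us) * ?W vs) + (\<Sum>i<m. \<omega> (?a i # omit i us) * ?W vs)"
    using length_omit [of _ us] us
    by (simp add: D_multiple_wedge [OF vs] bracket_multiple_wedge [OF vs] sum_negf)
  \<comment> \<open>The coefficients \<open>?a i\<close> are exactly those in the expansion of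
    \<open>D (\<omega> us)\<close>.\<close>
  also have "\<dots> = 0"
    using D_bracket_head [OF us] us by (simp add: sum_distrib_right)
  finally show ?thesis by simp
qed

text \<open>By \<open>wedge_head\<close> the outer operator is \<open>D\<close>, covered by
  \<open>wedge_self\<close>, or a bracket, which anticommutes past \<open>D\<close> to meet
  \<open>\<omega>\<close> and vanish by strongness.\<close>

lemma wedge_wedge_head_eq_0:
  assumes us: "length us = m" and vs: "length vs = Suc (Suc m)"
  shows "wedge scale (\<lambda>y. wedge scale D \<omega> (y # us)) (wedge scale D \<omega>) vs = 0"
proof -
  have "wedge scale (\<lambda>y. \<omega> (y # omit i us)) (wedge scale D \<omega>) vs = 0" if "i < m" for i
  proof -
    have "wedge scale D (wedge scale (\<lambda>y. \<omega> (y # omit i us)) \<omega>) vs = wedge scale D (\<lambda>w. 0) vs"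
      using that us vs length_omit [of i us] by (intro wedge_cong) (simp_all add: wedge_bracket_eq_0)
    then show ?thesis
      by (subst wedge_anticommute) (simp add: wedge_def [of scale D "\<lambda>w. 0"])
  qed
  then show ?thesis
    using us
    by (simp add: wedge_head wedge_diff_left wedge_sum_left wedge_mult_left_left wedge_self
        del: wedge_Cons)
qed

lemma strong_m_lie_poisson_algebra_wedge:
  "strong_m_lie_poisson_algebra scale (m + 1) (wedge scale D \<omega>)"
proof (intro strong_m_lie_poisson_algebra.intro strong_m_lie_poisson_algebra_axioms.intro
    m_lie_poisson_algebra.intro m_lie_poisson_algebra_axioms.intro
    m_lie_algebra.intro m_lie_algebra_axioms.intro comm_assoc_algebra_axioms vector_space_axioms)
  let ?W = "wedge scale D \<omega>"
  have last: "?W (us @ [y]) = scale ((-1) ^ length us) (?W (y # us))" if "length us = m" for us y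
    using adj_skew_last [of us ?W] adj_skew_D_wedge that by (simp del: wedge_Cons)
  show "1 \<le> m + 1" by simp
  show lin: "Vector_Spaces.linear scale scale (\<lambda>x. ?W (us[i := x]))"
    if "length us = m + 1" "i < m + 1" for us i
    using multilinear_onD [OF multilinear_on_D_wedge, of "take i us" "drop (Suc i) us"] that
    by (simp add: upd_conv_take_nth_drop)
  show "?W (us[i := us ! j, j := us ! i]) = - ?W us"
    if "length us = m + 1" "i < m + 1" "j < m + 1" "i \<noteq> j" for us i j
    using that adj_skew_D_wedge by (intro adj_skew_swap [of "m + 1"]) simp_all
  show "?W (us @ [?W vs]) = (\<Sum>i<m + 1. ?W (vs[i := ?W (us @ [vs ! i])]))"
    if us: "length us = m + 1 - 1" and vs: "length vs = m + 1" for us vs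
  proof -
    \<comment> \<open>Homogeneity extracts the sign from \<open>last\<close> inside the Leibniz sum,
      matching the sign on the left.\<close>
    have "?W (vs[i := scale c x]) = scale c (?W (vs[i := x]))" if "i < m + 1" for i c x
      using lin [OF vs that] by (simp add: linear_iff_add_scale)
    then show ?thesis
      using lie_identity_wedge_head [of us vs] us vs
      by (simp add: last leibniz_sum_def scale_sum_right scale_right_distrib
          del: wedge_Cons)
  qed
  show "?W ((x * y) # us) = x * ?W (y # us) + y * ?W (x # us)"
    if us: "length us = m + 1 - 1" for x y us
  proof -
    have "wedge scale D (\<lambda>z. \<omega> ((x * y) # z)) us
        = wedge scale D (\<lambda>z. x * \<omega> (y # z) + y * \<omega> (x # z)) us"
      using us by (intro wedge_cong) (auto intro!: leibniz)
    then show ?thesis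
      by (simp add: wedge_add wedge_mult_left D_mult algebra_simps)
  qed
  show "strong_form scale (m + 1) ?W us vs = 0"
    if "length us = m + 1 - 1" "length vs = m + 1 + 1" for us vs
    using that wedge_wedge_head_eq_0 [of us vs]
    by (simp add: strong_form_eq_wedge last wedge_scale_left del: wedge_Cons)
qed

end

end

theorem theorem6p1:
  fixes scale :: "'k::field_char_0 \<Rightarrow> 'u::comm_ring \<Rightarrow> 'u"
    and n :: nat and \<omega> :: "'u list \<Rightarrow> 'u" and D :: "'u \<Rightarrow> 'u"
  assumes "n \<ge> 1"
    and "strong_m_lie_poisson_algebra scale n \<omega>"
    and "D \<in> Der scale n \<omega>"
  shows "strong_m_lie_poisson_algebra scale (n + 1) (wedge scale D \<omega>)"
  using strong_m_lie_poisson_algebra.strong_m_lie_poisson_algebra_wedge assms(2,3) .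

end
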